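(* (Power identity.) Let $(a,H,\phi,\dot\phi)$ be the FLRW solution on its maximal existence interval $(\mathcal{T}_-,\mathcal{T}_+)$. The following identity holds for all $t\in(\mathcal{T}_-,\mathcal{T}_+)$: $$\mathcal{P}:=H\left(\left(2H^2-1-\frac{\dot H}{3H^2}\right)\dot\phi^2-8H^3\phi\dot\phi-12H^6\left(1+\frac{\dot H}{H^2}\right)\phi^2\right)=0.$$
   Context: An FLRW solution (of Einstein-scalar-Gauss-Bonnet gravity with quadratic coupling) means real functions $a>0$, $H=\dot a/a$, $\phi$ of $t$ (dot $=d/dt$), with $(a,H,\phi,\dot\phi)$ of class $C^1$, satisfying $$3H^2=\dot\phi^2+12H^3\phi\dot\phi\quad(\text{constraint}),$$ $$2\dot H+3H^2=-\dot\phi^2+8(\dot H+H^2)H\phi\dot\phi+4H^2(\dot\phi^2+\phi\ddot\phi),$$ $$\ddot\phi=-3\dot\phi H-6\phi(H^2+\dot H)H^2,$$ with initial data $(a,H,\phi)|_{t=0}=(a_0,\beta,\alpha)$ and $\dot\phi(0)$ one of the two roots $-6\alpha\beta^3\pm\sqrt{(6\alpha\beta^3)^2+3\beta^2}$ of the constraint. $\mathcal{T}_-\in[-\infty,0)$ and $\mathcal{T}_+\in(0,+\infty]$ are the maximal backward and forward existence times of the solution. *)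

theory Defs
  imports "HOL-Analysis.Analysis"
begin

text \<open>
  FLRW solutions of Einstein-scalar-Gauss-Bonnet gravity with quadratic coupling, on the open
  time interval from \<open>Tm\<close> to \<open>Tp\<close>, whose ends may be infinite.
\<close>

definition flrw_solution ::
  "ereal \<Rightarrow> ereal \<Rightarrow> (real \<Rightarrow> real) \<Rightarrow> (real \<Rightarrow> real) \<Rightarrow> (real \<Rightarrow> real) \<Rightarrow> bool" where
  "flrw_solution Tm Tp a H \<phi> \<longleftrightarrow>
     a C1_differentiable_on einterval Tm Tp \<and>
     H C1_differentiable_on einterval Tm Tp \<and>
     \<phi> C1_differentiable_on einterval Tm Tp \<and>
     deriv \<phi> C1_differentiable_on einterval Tm Tp \<and>
     (\<forall>t \<in> einterval Tm Tp.
        a t > 0 \<and>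
        H t = deriv a t / a t \<and>
        3 * (H t)^2 = (deriv \<phi> t)^2 + 12 * (H t)^3 * \<phi> t * deriv \<phi> t \<and>
        2 * deriv H t + 3 * (H t)^2 =
          - ((deriv \<phi> t)^2) + 8 * (deriv H t + (H t)^2) * H t * \<phi> t * deriv \<phi> t
          + 4 * (H t)^2 * ((deriv \<phi> t)^2 + \<phi> t * deriv (deriv \<phi>) t) \<and>
        deriv (deriv \<phi>) t =
          - 3 * deriv \<phi> t * H t - 6 * \<phi> t * ((H t)^2 + deriv H t) * (H t)^2)"

definition flrw_initial_data ::
  "real \<Rightarrow> real \<Rightarrow> real \<Rightarrow> (real \<Rightarrow> real) \<Rightarrow> (real \<Rightarrow> real) \<Rightarrow> (real \<Rightarrow> real) \<Rightarrow> bool" where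
  "flrw_initial_data a\<^sub>0 \<beta> \<alpha> a H \<phi> \<longleftrightarrow>
     a 0 = a\<^sub>0 \<and> H 0 = \<beta> \<and> \<phi> 0 = \<alpha> \<and>
     (deriv \<phi> 0 = - 6 * \<alpha> * \<beta>^3 + sqrt ((6 * \<alpha> * \<beta>^3)^2 + 3 * \<beta>^2) \<or>
      deriv \<phi> 0 = - 6 * \<alpha> * \<beta>^3 - sqrt ((6 * \<alpha> * \<beta>^3)^2 + 3 * \<beta>^2))"

text \<open>
  Maximality means that the solution does not extend to a solution on a strictly larger open
  interval. Agreement of the scalar fields on an open interval containing \<open>0\<close> makes an extension
  keep the chosen root for \<open>deriv \<phi> 0\<close>.
\<close>

definition maximal_flrw_solution ::
  "real \<Rightarrow> real \<Rightarrow> real \<Rightarrow> ereal \<Rightarrow> ereal \<Rightarrow>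
   (real \<Rightarrow> real) \<Rightarrow> (real \<Rightarrow> real) \<Rightarrow> (real \<Rightarrow> real) \<Rightarrow> bool" where
  "maximal_flrw_solution a\<^sub>0 \<beta> \<alpha> Tm Tp a H \<phi> \<longleftrightarrow>
     Tm < 0 \<and> 0 < Tp \<and>
     flrw_solution Tm Tp a H \<phi> \<and>
     flrw_initial_data a\<^sub>0 \<beta> \<alpha> a H \<phi> \<and>
     (\<forall>Sm Sp b K \<psi>.
        Sm \<le> Tm \<longrightarrow> Tp \<le> Sp \<longrightarrow> flrw_solution Sm Sp b K \<psi> \<longrightarrow>
        (\<forall>t \<in> einterval Tm Tp. b t = a t \<and> K t = H t \<and> \<psi> t = \<phi> t) \<longrightarrow>
        Sm = Tm \<and> Sp = Tp)"

text \<open>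
  The quotients by \<open>(H t)^2\<close> are meant for \<open>H t \<noteq> 0\<close>. The constraint and local uniqueness show
  that \<open>H\<close> either never vanishes (\<open>H 0 \<noteq> 0\<close>) or vanishes identically (\<open>H 0 = 0\<close>); in the latter
  case the convention \<open>x / 0 = 0\<close> applies.
\<close>

definition flrw_power :: "(real \<Rightarrow> real) \<Rightarrow> (real \<Rightarrow> real) \<Rightarrow> real \<Rightarrow> real" where
  "flrw_power H \<phi> t =
     H t * ((2 * (H t)^2 - 1 - deriv H t / (3 * (H t)^2)) * (deriv \<phi> t)^2
            - 8 * (H t)^3 * \<phi> t * deriv \<phi> t
            - 12 * (H t)^6 * (1 + deriv H t / (H t)^2) * (\<phi> t)^2)"

end

theory Submission
  imports Defs
begin

text \<open>
  The identity is pointwise and algebraic. Substituting the scalar field equation into the second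
  Friedmann equation gives a relation which differs from \<open>- 2\<close> times the bracket of the power by
  \<open>(1 + 2 * deriv H t / (3 * (H t)^2))\<close> times the constraint.
\<close>

lemma power_bracket_eq_zero:
  fixes h k p q r :: real
  assumes "h \<noteq> 0"
    and constraint: "3 * h^2 = q^2 + 12 * h^3 * p * q"
    and friedmann: "2 * k + 3 * h^2 =
      - (q^2) + 8 * (k + h^2) * h * p * q + 4 * h^2 * (q^2 + p * r)"
    and scalar: "r = - 3 * q * h - 6 * p * (h^2 + k) * h^2"
  shows "(2 * h^2 - 1 - k / (3 * h^2)) * q^2 - 8 * h^3 * p * q
    - 12 * h^6 * (1 + k / h^2) * p^2 = 0"
proof -
  \<comment> \<open>Writing \<open>k\<close> as \<open>u * h^2\<close> turns every quotient by
    \<open>h^2\<close> into a polynomial in \<open>u\<close>, so that the claim is within reach of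
    \<open>algebra\<close>.\<close>
  define u where "u = k / h^2"
  have k: "k = u * h^2"
    using \<open>h \<noteq> 0\<close> by (simp add: u_def)
  have "(2 * h^2 - 1 - u / 3) * q^2 - 8 * h^3 * p * q - 12 * h^6 * (1 + u) * p^2 = 0"
    \<comment> \<open>With \<open>r\<close> and \<open>k\<close> eliminated, the Friedmann relation
      is \<open>- 2\<close> times the goal plus \<open>1 + 2 * u / 3\<close> times the
      constraint.\<close>
    using constraint friedmann unfolding scalar k by algebra
  moreover have "k / (3 * h^2) = u / 3"
    by (simp add: u_def)
  ultimately show ?thesis
    by (simp only: u_def)
qed

theorem lemma3p1:
  fixes a\<^sub>0 \<beta> \<alpha> :: real and Tm Tp :: ereal and a H \<phi> :: "real \<Rightarrow> real"
  assumes "maximal_flrw_solution a\<^sub>0 \<beta> \<alpha> Tm Tp a H \<phi>"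
  shows "\<forall>t \<in> einterval Tm Tp. flrw_power H \<phi> t = 0"
proof
  fix t
  assume "t \<in> einterval Tm Tp"
  then have
    "3 * (H t)^2 = (deriv \<phi> t)^2 + 12 * (H t)^3 * \<phi> t * deriv \<phi> t"
    "2 * deriv H t + 3 * (H t)^2 =
      - ((deriv \<phi> t)^2) + 8 * (deriv H t + (H t)^2) * H t * \<phi> t * deriv \<phi> t
      + 4 * (H t)^2 * ((deriv \<phi> t)^2 + \<phi> t * deriv (deriv \<phi>) t)"
    "deriv (deriv \<phi>) t =
      - 3 * deriv \<phi> t * H t - 6 * \<phi> t * ((H t)^2 + deriv H t) * (H t)^2"
    using assms unfolding maximal_flrw_solution_def flrw_solution_def by blast+
  then show "flrw_power H \<phi> t = 0"
    \<comment> \<open>Where \<open>H t = 0\<close> the outer factor \<open>H t\<close> already gives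
      zero, whatever value the quotients take.\<close>
    unfolding flrw_power_def using power_bracket_eq_zero by (cases "H t = 0") auto
qed

end
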